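(* Consider the $K$-server pricing system with Poisson arrivals of rate $\lambda$, with the number of servers $K\in\mathbb{N}$, the service rate $\mu>0$ and the valuation distribution $G$ fixed, and let $\theta^*(\lambda)=\max_{\mathbf p\in\mathbb{R}_+^K}R(K,\mathbf p)$ be its optimal revenue rate as a function of $\lambda>0$. Then: (a) $\theta^*(\lambda)$ is (strictly) increasing in $\lambda$; (b) $\theta^*(\lambda)/\lambda$ is (strictly) decreasing in $\lambda$.
   Context: Model: jobs arrive according to a Poisson process of rate $\lambda$ at a system of $K$ servers with no waiting room; service times are i.i.d. exponential with mean $1/\mu$; valuations are i.i.d., independent of everything else, positive, with continuous distribution function $G$ and finite mean; $\overline{G}(u)=P(V\ge u)$ for a generic valuation $V$. A price vector is $\mathbf p=(p_0,\dots,p_{K-1})\in\mathbb{R}_+^K$; a job finding $k\le K-1$ busy servers joins and pays $p_k$ iff its valuation is at least $p_k$; otherwise, or if all $K$ servers are busy, it leaves. The revenue rate $R(K,\mathbf p)=\lim_{t\to\infty}\mathbb{E}[\text{revenue in }[0,t]]/t$ equals $\sum_{k=0}^{K-1}\pi_k\,\lambda\,\overline{G}(p_k)\,p_k$, where, with $\rho=\lambda/\mu$, $\pi_k=\pi_0\frac{\rho^k}{k!}\prod_{j=0}^{k-1}\overline{G}(p_j)$ for $1\le k\le K$ and $\pi_0=\big[1+\sum_{k=1}^K\frac{\rho^k}{k!}\prod_{j=0}^{k-1}\overline{G}(p_j)\big]^{-1}$. Standing assumption: a finite optimal price vector (a maximizer of $R(K,\cdot)$) exists. *)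

theory Defs
  imports "HOL-Probability.Probability"
begin

text \<open>
  The K-server loss system with state-dependent prices. The valuations enter only through
  their common law \<open>D\<close>, a probability measure on the reals; the distribution function
  \<open>G\<close> is \<open>cdf D\<close>. A job seeing \<open>k < K\<close> busy servers is admitted with probability
  \<open>P(V \<ge> p k)\<close>, so the number of busy servers is a birth-death chain on \<open>{0..K}\<close>, with
  birth rate \<open>\<lambda> * P(V \<ge> p k)\<close> in state \<open>k\<close> and death rate \<open>k * \<mu>\<close>.
\<close>

definition valuation_law :: "real measure \<Rightarrow> bool" where
  "valuation_law D \<longleftrightarrow>
     real_distribution D \<and>
     (AE v in D. 0 < v) \<and>
     continuous_on UNIV (cdf D) \<and>
     integrable D (\<lambda>v. v)"

text \<open>Note the closed half-line: a job whose valuation equals the price joins.\<close>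

definition join_prob :: "real measure \<Rightarrow> real \<Rightarrow> real" where
  "join_prob D u = measure D {u..}"

text \<open>
  Extensional functions on \<open>{..<K}\<close>, so that this set is in bijection with the nonnegative
  orthant of K-dimensional space.
\<close>

definition price_vectors :: "nat \<Rightarrow> (nat \<Rightarrow> real) set" where
  "price_vectors K = {..<K} \<rightarrow>\<^sub>E {0..}"

definition state_weight :: "real \<Rightarrow> real \<Rightarrow> real measure \<Rightarrow> (nat \<Rightarrow> real) \<Rightarrow> nat \<Rightarrow> real" where
  "state_weight l \<mu> D p k = (l / \<mu>) ^ k / fact k * (\<Prod>j<k. join_prob D (p j))"

definition idle_prob :: "real \<Rightarrow> real \<Rightarrow> real measure \<Rightarrow> nat \<Rightarrow> (nat \<Rightarrow> real) \<Rightarrow> real" where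
  "idle_prob l \<mu> D K p = inverse (1 + (\<Sum>k=1..K. state_weight l \<mu> D p k))"

text \<open>The stationary probability of \<open>k\<close> busy servers, meaningful for \<open>k \<le> K\<close>.\<close>

definition state_prob :: "real \<Rightarrow> real \<Rightarrow> real measure \<Rightarrow> nat \<Rightarrow> (nat \<Rightarrow> real) \<Rightarrow> nat \<Rightarrow> real" where
  "state_prob l \<mu> D K p k = idle_prob l \<mu> D K p * state_weight l \<mu> D p k"

text \<open>The two lemmas below identify \<open>state_prob\<close> as the stationary law of this chain.\<close>

lemma state_prob_balance:
  assumes "\<mu> > 0"
  shows "state_prob l \<mu> D K p k * (l * join_prob D (p k)) =
         state_prob l \<mu> D K p (Suc k) * (real (Suc k) * \<mu>)"
  using assms by (simp add: state_prob_def state_weight_def field_simps del: of_nat_Suc)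

lemma state_prob_sum:
  assumes "l > 0" "\<mu> > 0"
  shows "(\<Sum>k\<le>K. state_prob l \<mu> D K p k) = 1"
proof -
  let ?w = "state_weight l \<mu> D p"
  have nonneg: "?w k \<ge> 0" for k
    using assms by (simp add: state_weight_def join_prob_def prod_nonneg)
  have "(\<Sum>k\<le>K. ?w k) = ?w 0 + (\<Sum>k=1..K. ?w k)"
    by (simp add: sum.atMost_shift sum.atLeast1_atMost_eq)
  also have "?w 0 = 1"
    by (simp add: state_weight_def)
  finally have eq: "(\<Sum>k\<le>K. ?w k) = 1 + (\<Sum>k=1..K. ?w k)" .
  have "1 + (\<Sum>k=1..K. ?w k) > 0"
    using sum_nonneg[of "{1..K}" ?w] nonneg by (simp add: add_pos_nonneg)
  then show ?thesis
    by (simp add: state_prob_def idle_prob_def eq flip: sum_distrib_left)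
qed

text \<open>Long-run average revenue per unit of time under the prices \<open>p\<close>.\<close>

definition revenue_rate :: "real \<Rightarrow> real \<Rightarrow> real measure \<Rightarrow> nat \<Rightarrow> (nat \<Rightarrow> real) \<Rightarrow> real" where
  "revenue_rate l \<mu> D K p =
     (\<Sum>k<K. state_prob l \<mu> D K p k * l * join_prob D (p k) * p k)"

definition optimal_prices :: "real \<Rightarrow> real \<Rightarrow> real measure \<Rightarrow> nat \<Rightarrow> (nat \<Rightarrow> real) \<Rightarrow> bool" where
  "optimal_prices l \<mu> D K p \<longleftrightarrow>
     is_arg_max (revenue_rate l \<mu> D K) (\<lambda>q. q \<in> price_vectors K) p"

text \<open>
  The maximum over price vectors; \<open>GREATEST\<close> denotes it only if the maximum is attained,
  that is, if some \<open>optimal_prices\<close> exist.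
\<close>

definition optimal_revenue :: "real \<Rightarrow> real measure \<Rightarrow> nat \<Rightarrow> real \<Rightarrow> real" where
  "optimal_revenue \<mu> D K l =
     (GREATEST r. r \<in> revenue_rate l \<mu> D K ` price_vectors K)"

end

theory Submission
  imports Defs
begin

text \<open>
  (a) If the arrival rate grows from \<open>l\<close> to \<open>l'\<close>, raise each price \<open>p k\<close> to a price at which the
  admission rate is unchanged. The occupancy process keeps its law and every admitted job pays
  more.

  (b) Let \<open>a = l / \<mu>\<close>, and let \<open>t\<close> be a candidate for the revenue per arriving job. Charging
  \<open>t\<close> for each arrival leads to the Bellman recursion \<open>V K = - t\<close>,
  \<open>V k = \<phi> (- a / (k + 1) * V (k + 1)) - t\<close> with \<open>\<phi> d = sup u. G u * (u - d)\<close>, where \<open>G\<close> is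
  \<open>join_prob D\<close>, and \<open>t\<close> is optimal iff \<open>V 0 = 0\<close>. In that case \<open>V k < 0\<close> for \<open>k \<ge> 1\<close>.
  As \<open>\<phi>\<close> is strictly decreasing where it is positive, increasing \<open>a\<close> without decreasing
  \<open>t\<close> makes \<open>V 0\<close> strictly smaller, so it cannot stay zero.
\<close>

section \<open>The demand function\<close>

lemma join_prob_nonneg [simp]: "0 \<le> join_prob D u"
  by (simp add: join_prob_def)

locale valuation =
  fixes D :: "real measure"
  assumes law: "valuation_law D"
begin

sublocale real_distribution D
  using law by (simp add: valuation_law_def)

lemma AE_valuation_pos: "AE v in D. 0 < v"
  and integrable_valuation: "integrable D (\<lambda>v. v)"
  and continuous_cdf: "continuous_on UNIV (cdf D)"
  using law by (simp_all add: valuation_law_def)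

lemma join_prob_le_1 [simp]: "join_prob D u \<le> 1"
  by (simp add: join_prob_def)

text \<open>Continuity of \<open>cdf D\<close> excludes an atom at \<open>u\<close>, so the closed
  and the open half-line have the same mass.\<close>

lemma join_prob_eq: "join_prob D u = 1 - cdf D u"
proof -
  have "isCont (cdf D) u"
    using continuous_cdf by (simp add: continuous_on_eq_continuous_at)
  then have "prob {u} = 0"
    by (simp add: isCont_cdf)
  moreover have "prob ({u<..} \<union> {u}) = prob {u<..} + prob {u}"
    by (intro finite_measure_Union) auto
  moreover have "{u<..} \<union> {u} = {u..}" "{u<..} = space D - {..u}"
    by auto
  moreover have "prob (space D - {..u}) = 1 - prob {..u}"
    by (rule prob_compl) auto
  ultimately show ?thesis
    by (simp add: join_prob_def cdf_def)
qed

lemma continuous_join_prob: "continuous_on A (join_prob D)"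
proof -
  have "continuous_on UNIV (\<lambda>u. 1 - cdf D u)"
    by (intro continuous_intros continuous_cdf)
  then have "continuous_on UNIV (join_prob D)"
    by (simp add: join_prob_eq)
  then show ?thesis
    by (rule continuous_on_subset) simp
qed

lemma join_prob_0: "join_prob D 0 = 1"
proof -
  have "AE v in D. v \<in> {0..}"
    using AE_valuation_pos by eventually_elim simp
  then show ?thesis
    unfolding join_prob_def by (subst prob_eq_1) auto
qed

text \<open>Markov's inequality with the truncated mean on the right: unlike the full mean, it
  vanishes as \<open>u\<close> grows.\<close>

lemma price_mult_join_prob_le:
  "u * join_prob D u \<le> (\<integral>v. indicator {u..} v * v \<partial>D)"
proof -
  have "u * join_prob D u = (\<integral>v. indicator {u..} v * u \<partial>D)"
    by (simp add: join_prob_def)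
  also have "\<dots> \<le> (\<integral>v. indicator {u..} v * v \<partial>D)"
  proof (rule integral_mono)
    show "integrable D (\<lambda>v. indicator {u..} v * u)"
      by (intro integrable_mult_left integrable_real_indicator) (auto simp: emeasure_eq_measure)
    show "integrable D (\<lambda>v. indicator {u..} v * v)"
      using integrable_real_mult_indicator[OF _ integrable_valuation, of "{u..}"]
      by (simp add: mult.commute)
  qed (auto simp: indicator_def)
  finally show ?thesis .
qed

lemma price_mult_join_prob_le_mean: "u * join_prob D u \<le> (\<integral>v. v \<partial>D)"
proof -
  have "(\<integral>v. indicator {u..} v * v \<partial>D) \<le> (\<integral>v. v \<partial>D)"
    using integrable_real_mult_indicator[OF _ integrable_valuation, of "{u..}"]
      AE_valuation_pos
    by (intro integral_mono_AE integrable_valuation)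
      (auto simp: indicator_def mult.commute)
  with price_mult_join_prob_le[of u] show ?thesis
    by linarith
qed

lemma price_mult_join_prob_tendsto: "((\<lambda>u. u * join_prob D u) \<longlongrightarrow> 0) at_top"
proof (rule tendsto_sandwich[where f = "\<lambda>_. 0"])
  have "((\<lambda>u. \<integral>v. indicator {u..} v * v \<partial>D) \<longlongrightarrow> (\<integral>v. 0 \<partial>D)) at_top"
  proof (rule integral_dominated_convergence_at_top)
    show "integrable D (\<lambda>v. \<bar>v\<bar>)"
      by (simp add: integrable_valuation)
    have "\<forall>\<^sub>F u in at_top. indicator {u..} v * v = 0" for v :: real
      using eventually_gt_at_top[of v] by eventually_elim simp
    then show "AE v in D. ((\<lambda>u. indicator {u..} v * v) \<longlongrightarrow> 0) at_top"
      by (simp add: tendsto_eventually)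
  qed (auto simp: indicator_def)
  then show "((\<lambda>u. \<integral>v. indicator {u..} v * v \<partial>D) \<longlongrightarrow> 0) at_top"
    by simp
  show "\<forall>\<^sub>F u in at_top. 0 \<le> u * join_prob D u"
    using eventually_ge_at_top[of 0] by eventually_elim simp
qed (auto intro: always_eventually price_mult_join_prob_le)

lemma join_prob_attains:
  assumes "0 < y" "y < join_prob D u"
  obtains u' where "u < u'" "join_prob D u' = y"
proof -
  have "\<forall>\<^sub>F x in at_top. x * join_prob D x < y"
    using order_tendstoD(2)[OF price_mult_join_prob_tendsto] assms by blast
  then have "\<forall>\<^sub>F x in at_top. x * join_prob D x < y \<and> 1 \<le> x \<and> u \<le> x"
    by (intro eventually_conj eventually_ge_at_top)
  then obtain x where x: "x * join_prob D x < y" "1 \<le> x" "u \<le> x"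
    by (auto simp: eventually_at_top_linorder)
  \<comment> \<open>From price 1 on, demand is at most revenue, so it has fallen below
    \<open>y\<close> at \<open>x\<close>; continuity then gives a price in between.\<close>
  have "join_prob D x \<le> x * join_prob D x"
    using x mult_right_mono[of 1 x "join_prob D x"] by simp
  then obtain u' where "u \<le> u'" "join_prob D u' = y"
    using IVT2'[of "join_prob D" x y u] x assms continuous_join_prob by auto
  with assms that show ?thesis
    by (metis less_irrefl order_le_less)
qed

lemma ex_profitable_price: "\<exists>u>0. 0 < join_prob D u"
proof -
  obtain u where "0 < u" "join_prob D u = 1 / 2"
    using join_prob_attains[of "1 / 2" 0] join_prob_0 by auto
  then show ?thesis
    by auto
qed

text \<open>The \<open>\<phi>\<close> of the overview: the best expected gain from one arrival when
  admission costs \<open>d\<close>. The supremum is finite because a finite mean bounds the revenue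
  \<open>u * join_prob D u\<close>.\<close>

definition surplus :: "real \<Rightarrow> real" where
  "surplus d = (SUP u\<in>{0..}. join_prob D u * (u - d))"

lemma bdd_above_surplus: "bdd_above ((\<lambda>u. join_prob D u * (u - d)) ` {0..})"
proof (rule bdd_aboveI2)
  fix u
  have "join_prob D u * (u - d) = u * join_prob D u - join_prob D u * d"
    by (simp add: algebra_simps)
  moreover have "\<bar>join_prob D u * d\<bar> \<le> \<bar>d\<bar>"
    by (simp add: abs_mult mult_left_le_one_le)
  ultimately show "join_prob D u * (u - d) \<le> (\<integral>v. v \<partial>D) + \<bar>d\<bar>"
    using price_mult_join_prob_le_mean[of u] by linarith
qed

lemma surplus_upper: "0 \<le> u \<Longrightarrow> join_prob D u * (u - d) \<le> surplus d"
  unfolding surplus_def by (intro cSUP_upper bdd_above_surplus) auto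

lemma surplus_least:
  assumes "\<And>u. 0 \<le> u \<Longrightarrow> join_prob D u * (u - d) \<le> c"
  shows "surplus d \<le> c"
  unfolding surplus_def using assms by (intro cSUP_least) auto

lemma less_surplusD: "c < surplus d \<Longrightarrow> \<exists>u\<ge>0. c < join_prob D u * (u - d)"
  using surplus_least[of d c] by (meson not_le)

lemma surplus_antimono:
  assumes "d \<le> d'"
  shows "surplus d' \<le> surplus d"
proof (rule surplus_least)
  fix u :: real
  assume "0 \<le> u"
  have "join_prob D u * (u - d') \<le> join_prob D u * (u - d)"
    using assms by (intro mult_left_mono) auto
  also have "\<dots> \<le> surplus d"
    using \<open>0 \<le> u\<close> by (rule surplus_upper)
  finally show "join_prob D u * (u - d') \<le> surplus d" .
qed

lemma surplus_0_pos: "0 < surplus 0"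
proof -
  obtain u where "u > 0" "0 < join_prob D u"
    using ex_profitable_price by blast
  then have "0 < join_prob D u * (u - 0)"
    by simp
  also have "\<dots> \<le> surplus 0"
    using \<open>u > 0\<close> by (intro surplus_upper) simp
  finally show ?thesis .
qed

text \<open>
  Prices yielding at least half of \<open>surplus d\<close> lie in a bounded interval, and their joining
  probability is therefore bounded away from zero.
\<close>

lemma surplus_strict:
  assumes "0 \<le> d" "d < d'" "0 < surplus d"
  shows "surplus d' < surplus d"
proof -
  define c where "c = surplus d"
  have "\<forall>\<^sub>F u in at_top. u * join_prob D u < c / 2"
    using assms by (intro order_tendstoD(2)[OF price_mult_join_prob_tendsto]) (simp add: c_def)
  then obtain M0 where M0: "\<And>u. M0 \<le> u \<Longrightarrow> u * join_prob D u < c / 2"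
    by (auto simp: eventually_at_top_linorder)
  define M where "M = max M0 1"
  \<comment> \<open>Pointwise strict inequalities could become an equality in the supremum, so a
    single bound below \<open>c\<close> has to serve all \<open>u\<close>.\<close>
  have "surplus d' \<le> max (c / 2) (c - c / (2 * M) * (d' - d))"
  proof (rule surplus_least)
    fix u :: real
    assume u: "0 \<le> u"
    show "join_prob D u * (u - d') \<le> max (c / 2) (c - c / (2 * M) * (d' - d))"
    proof (cases "u * join_prob D u < c / 2")
      case True
      have "0 \<le> join_prob D u * d'"
        using assms by simp
      with True show ?thesis
        by (simp add: algebra_simps)
    next
      case False
      then have "u < M"
        using M0[of u] by (force simp: M_def)
      then have "c / 2 \<le> M * join_prob D u"
        using False mult_right_mono[of u M "join_prob D u"] by simp
      then have "c / (2 * M) \<le> join_prob D u"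
        by (simp add: M_def field_simps)
      then have "c / (2 * M) * (d' - d) \<le> join_prob D u * (d' - d)"
        using assms by (intro mult_right_mono) auto
      moreover have "join_prob D u * (u - d) \<le> c"
        unfolding c_def using u by (rule surplus_upper)
      ultimately show ?thesis
        by (simp add: algebra_simps)
    qed
  qed
  also have "\<dots> < c"
    using assms by (simp add: c_def M_def)
  finally show ?thesis
    by (simp add: c_def)
qed

end

section \<open>The revenue rate and the Bellman recursion\<close>

context
  fixes D :: "real measure" and a t :: real and K :: nat
begin

text \<open>
  \<open>excess q k\<close> is the total over the states from \<open>k\<close> on of the revenue per arrival minus \<open>t\<close>,
  each state being weighted relative to \<open>k\<close>.
\<close>

function excess :: "(nat \<Rightarrow> real) \<Rightarrow> nat \<Rightarrow> real" where
  "excess q k = (if k < K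
     then join_prob D (q k) * (q k + a / real (Suc k) * excess q (Suc k)) - t else - t)"
  by pat_completeness auto
termination
  by (relation "Wellfounded.measure (\<lambda>(q, k). K - k)") auto

declare excess.simps [simp del]

lemma excess_less:
  "k < K \<Longrightarrow> excess q k =
     join_prob D (q k) * (q k + a / real (Suc k) * excess q (Suc k)) - t"
  and excess_ge: "K \<le> k \<Longrightarrow> excess q k = - t"
  by (simp_all add: excess.simps)

lemma excess_cong:
  assumes "k \<le> K" "\<And>j. k \<le> j \<Longrightarrow> j < K \<Longrightarrow> q j = q' j"
  shows "excess q k = excess q' k"
  using assms by (induction k rule: inc_induct) (simp_all add: excess_less excess_ge)

end

context valuation
begin

context
  fixes a t :: real and K :: nat
begin

text \<open>The \<open>V\<close> of the overview. In state \<open>K\<close> an arrival is lost but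
  still charged, hence \<open>- t\<close>.\<close>

function value_fn :: "nat \<Rightarrow> real" where
  "value_fn k = (if k < K then surplus (- (a / real (Suc k) * value_fn (Suc k))) - t else - t)"
  by pat_completeness auto
termination
  by (relation "Wellfounded.measure (\<lambda>k. K - k)") auto

declare value_fn.simps [simp del]

lemma value_fn_less:
  "k < K \<Longrightarrow> value_fn k = surplus (- (a / real (Suc k) * value_fn (Suc k))) - t"
  and value_fn_ge: "K \<le> k \<Longrightarrow> value_fn k = - t"
  by (simp_all add: value_fn.simps)

text \<open>Backward induction from \<open>K\<close>: since \<open>a \<ge> 0\<close>, a larger
  continuation value can only help, and \<open>surplus\<close> dominates every choice of the current
  price.\<close>

lemma excess_le_value_fn:
  assumes "0 \<le> a" "q \<in> price_vectors K" "k \<le> K"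
  shows "excess D a t K q k \<le> value_fn k"
  using \<open>k \<le> K\<close>
proof (induction k rule: inc_induct)
  case base
  then show ?case
    by (simp add: excess_ge value_fn_ge)
next
  case (step k)
  let ?c = "a / real (Suc k)"
  have "q k \<ge> 0"
    using assms step by (auto simp: price_vectors_def)
  have "join_prob D (q k) * (q k + ?c * excess D a t K q (Suc k))
      \<le> join_prob D (q k) * (q k - (- (?c * value_fn (Suc k))))"
    using assms step.IH by (simp add: mult_left_mono divide_right_mono del: of_nat_Suc)
  also have "\<dots> \<le> surplus (- (?c * value_fn (Suc k)))"
    using \<open>q k \<ge> 0\<close> by (rule surplus_upper)
  finally show ?case
    using step by (simp add: excess_less value_fn_less del: of_nat_Suc)
qed

text \<open>Converse of the previous bound: \<open>value_fn k\<close> is the supremum of the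
  excesses. As \<open>surplus\<close> is itself a supremum, prices are only chosen nearly optimal,
  state by state.\<close>

lemma less_value_fnD:
  assumes "0 \<le> a" "k \<le> K" "x < value_fn k"
  shows "\<exists>q\<in>price_vectors K. x < excess D a t K q k"
  using assms(2,3)
proof (induction k arbitrary: x rule: inc_induct)
  case base
  have "restrict (\<lambda>_. 0) {..<K} \<in> price_vectors K"
    by (auto simp: price_vectors_def)
  with base show ?case
    by (auto simp: excess_ge value_fn_ge)
next
  case (step k)
  define c where "c = a / real (Suc k)"
  have "c \<ge> 0"
    using assms by (simp add: c_def)
  from step have "x + t < surplus (- (c * value_fn (Suc k)))"
    by (simp add: value_fn_less c_def del: of_nat_Suc)
  then obtain u where u: "0 \<le> u" "x + t < join_prob D u * (u + c * value_fn (Suc k))"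
    using less_surplusD by fastforce
  \<comment> \<open>The slack left by \<open>u\<close>, divided by \<open>c + 1\<close>: an error
    \<open>e\<close> in the continuation costs at most \<open>c * e\<close>, which is less than the
    slack, also when \<open>c = 0\<close>.\<close>
  define e where "e = (join_prob D u * (u + c * value_fn (Suc k)) - (x + t)) / (c + 1)"
  have "e > 0"
    using u \<open>c \<ge> 0\<close> by (simp add: e_def)
  then obtain q where q: "q \<in> price_vectors K"
      "value_fn (Suc k) - e < excess D a t K q (Suc k)"
    using step.IH[of "value_fn (Suc k) - e"] by auto
  define q' where "q' = q(k := u)"
  have "q' \<in> price_vectors K"
    using q u step by (auto simp: q'_def price_vectors_def PiE_iff extensional_def)
  have same: "excess D a t K q' (Suc k) = excess D a t K q (Suc k)"
    using step by (intro excess_cong) (auto simp: q'_def)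
  have "c * (value_fn (Suc k) - e) \<le> c * excess D a t K q (Suc k)"
    using q \<open>c \<ge> 0\<close> by (intro mult_left_mono) auto
  then have "join_prob D u * (u + c * value_fn (Suc k) - c * e)
      \<le> join_prob D u * (u + c * excess D a t K q (Suc k))"
    by (intro mult_left_mono) (auto simp: algebra_simps)
  moreover have "join_prob D u * (c * e) \<le> c * e"
    using \<open>c \<ge> 0\<close> \<open>e > 0\<close> by (simp add: mult_left_le_one_le)
  moreover have "c * e + e = join_prob D u * (u + c * value_fn (Suc k)) - (x + t)"
  proof -
    have "e * (c + 1) = join_prob D u * (u + c * value_fn (Suc k)) - (x + t)"
      using \<open>c \<ge> 0\<close> by (simp add: e_def)
    then show ?thesis
      by (simp add: algebra_simps)
  qed
  ultimately have "x + t < join_prob D u * (u + c * excess D a t K q (Suc k))"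
    using \<open>e > 0\<close> by (simp add: algebra_simps)
  then have "x < excess D a t K q' k"
    using step by (simp add: excess_less same c_def del: of_nat_Suc) (simp add: q'_def)
  with \<open>q' \<in> price_vectors K\<close> show ?case
    by blast
qed

text \<open>If \<open>value_fn 1\<close> were nonnegative, \<open>value_fn 0 = 0\<close> would force
  \<open>surplus 0 \<le> t\<close>, and backward induction from \<open>- t\<close> would make all
  values negative, even the one at 0. From \<open>value_fn 1 < 0\<close> the sign spreads upwards: a
  negative value at a state means a surplus below \<open>t = surplus (- (a * value_fn 1))\<close>,
  hence an admission cost above a positive one, hence a negative next value.\<close>

lemma value_fn_neg:
  assumes "0 < a" "0 < t" "value_fn 0 = 0" "0 < k" "k \<le> K"
  shows "value_fn k < 0"
proof -
  have "K > 0"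
    using assms by simp
  have t: "surplus (- (a * value_fn 1)) = t"
    using assms \<open>K > 0\<close> value_fn_less[of 0] by simp
  have "value_fn 1 < 0"
  proof (rule ccontr)
    assume "\<not> value_fn 1 < 0"
    then have "surplus 0 \<le> t"
      using assms surplus_antimono[of "- (a * value_fn 1)" 0] t by simp
    have "j \<le> K \<Longrightarrow> value_fn j < 0" for j
    proof (induction j rule: inc_induct)
      case base
      then show ?case
        using assms by (simp add: value_fn_ge)
    next
      case (step j)
      then have "0 < - (a / real (Suc j) * value_fn (Suc j))"
        using assms mult_pos_neg[of "a / real (Suc j)" "value_fn (Suc j)"]
        by (simp del: of_nat_Suc)
      then have "surplus (- (a / real (Suc j) * value_fn (Suc j))) < surplus 0"
        using surplus_0_pos by (intro surplus_strict) auto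
      with \<open>surplus 0 \<le> t\<close> step show ?case
        by (simp add: value_fn_less del: of_nat_Suc)
    qed
    with assms show False
      by force
  qed
  have "Suc j \<le> K \<Longrightarrow> value_fn (Suc j) < 0" for j
  proof (induction j)
    case 0
    then show ?case
      using \<open>value_fn 1 < 0\<close> by simp
  next
    case (Suc j)
    let ?d = "- (a / real (Suc (Suc j)) * value_fn (Suc (Suc j)))"
    have "surplus ?d < t"
      using Suc by (simp add: value_fn_less del: of_nat_Suc)
    then have "- (a * value_fn 1) < ?d"
      using t surplus_antimono[of ?d "- (a * value_fn 1)"] by linarith
    moreover have "0 < - (a * value_fn 1)"
      using assms \<open>value_fn 1 < 0\<close> by (simp add: mult_pos_neg)
    ultimately have "a / real (Suc (Suc j)) * value_fn (Suc (Suc j)) < 0"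
      by linarith
    then show ?case
      using assms by (simp add: mult_less_0_iff zero_less_divide_iff divide_less_0_iff del: of_nat_Suc)
  qed
  from this[of "k - 1"] assms show ?thesis
    by simp
qed

end

text \<open>If \<open>t \<le> t'\<close>, backward induction gives \<open>?V' \<le> ?V\<close> on
  the positive states. As \<open>?V\<close> is negative there, the larger \<open>a'\<close> strictly
  raises the admission cost in state 0, and \<open>surplus\<close>, being positive there, strictly
  drops.\<close>

lemma value_fn_root_strict:
  assumes "1 \<le> K" "0 < a" "a < a'" "0 < t"
    and "value_fn a t K 0 = 0" "value_fn a' t' K 0 = 0"
  shows "t' < t"
proof (rule ccontr)
  assume "\<not> t' < t"
  then have "t \<le> t'"
    by simp
  let ?V = "value_fn a t K" and ?V' = "value_fn a' t' K"
  have neg: "?V k < 0" if "0 < k" "k \<le> K" for k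
    using that assms by (intro value_fn_neg) auto
  have le: "?V' k \<le> ?V k" if "k \<le> K" "0 < k" for k
    using that
  proof (induction k rule: inc_induct)
    case base
    then show ?case
      using \<open>t \<le> t'\<close> by (simp add: value_fn_ge)
  next
    case (step k)
    have "?V' (Suc k) \<le> ?V (Suc k)" "?V (Suc k) < 0"
      using step neg by auto
    then have "a * - ?V (Suc k) \<le> a' * - ?V' (Suc k)"
      using assms by (intro mult_mono) auto
    then have "- (a / real (Suc k) * ?V (Suc k)) \<le> - (a' / real (Suc k) * ?V' (Suc k))"
      by (simp add: divide_right_mono del: of_nat_Suc)
    then have "surplus (- (a' / real (Suc k) * ?V' (Suc k)))
        \<le> surplus (- (a / real (Suc k) * ?V (Suc k)))"
      by (rule surplus_antimono)
    then show ?case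
      using step \<open>t \<le> t'\<close> by (simp add: value_fn_less del: of_nat_Suc)
  qed
  have "?V 1 < 0" "?V' 1 \<le> ?V 1"
    using neg le assms by auto
  have "a * - ?V 1 < a' * - ?V 1"
    using \<open>?V 1 < 0\<close> assms by (intro mult_strict_right_mono) auto
  also have "\<dots> \<le> a' * - ?V' 1"
    using \<open>?V' 1 \<le> ?V 1\<close> assms by (intro mult_left_mono) auto
  finally have "- (a * ?V 1) < - (a' * ?V' 1)"
    by simp
  moreover have "surplus (- (a * ?V 1)) = t" "surplus (- (a' * ?V' 1)) = t'"
    using assms value_fn_less[of 0 K a t] value_fn_less[of 0 K a' t'] by auto
  moreover have "0 \<le> - (a * ?V 1)"
    using \<open>?V 1 < 0\<close> assms by (simp add: mult_pos_neg less_imp_le)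
  ultimately have "t' < t"
    using surplus_strict \<open>0 < t\<close> by metis
  with \<open>t \<le> t'\<close> show False
    by simp
qed

end

section \<open>From excesses to the stationary revenue rate\<close>

lemma state_weight_nonneg: "0 < l \<Longrightarrow> 0 < \<mu> \<Longrightarrow> 0 \<le> state_weight l \<mu> D q k"
  by (simp add: state_weight_def prod_nonneg)

lemma idle_prob_pos: "0 < l \<Longrightarrow> 0 < \<mu> \<Longrightarrow> 0 < idle_prob l \<mu> D K q"
  unfolding idle_prob_def
  by (simp add: add_pos_nonneg sum_nonneg state_weight_nonneg)

lemma state_prob_nonneg: "0 < l \<Longrightarrow> 0 < \<mu> \<Longrightarrow> 0 \<le> state_prob l \<mu> D K q k"
  by (simp add: state_prob_def state_weight_nonneg idle_prob_pos less_imp_le)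

text \<open>The factor in front of the next excess in the recursion is exactly the ratio of
  successive state weights, so unrolling from state 0 accumulates these weights.\<close>

lemma excess_partial_sum:
  assumes "\<mu> \<noteq> 0" "m \<le> K"
  shows "excess D (l / \<mu>) t K q 0 =
    (\<Sum>k<m. state_weight l \<mu> D q k * (join_prob D (q k) * q k - t))
      + state_weight l \<mu> D q m * excess D (l / \<mu>) t K q m"
  using \<open>m \<le> K\<close>
proof (induction m)
  case 0
  then show ?case
    by (simp add: state_weight_def)
next
  case (Suc m)
  have "state_weight l \<mu> D q (Suc m) =
      state_weight l \<mu> D q m * (join_prob D (q m) * (l / \<mu> / real (Suc m)))"
    by (simp add: state_weight_def mult_ac)
  with Suc show ?case
    by (simp add: excess_less algebra_simps del: of_nat_Suc)
qed

text \<open>Revenue per arrival is a ratio of weighted sums, and the excess at 0 is its numerator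
  minus \<open>t\<close> times its denominator, as in fractional programming. Hence the sign of the
  excess tells whether \<open>q\<close> beats \<open>t\<close>.\<close>

lemma revenue_rate_excess:
  assumes "0 < l" "0 < \<mu>"
  shows "revenue_rate l \<mu> D K q - l * t = l * idle_prob l \<mu> D K q * excess D (l / \<mu>) t K q 0"
proof -
  let ?w = "state_weight l \<mu> D q"
  have "excess D (l / \<mu>) t K q 0 =
      (\<Sum>k<K. ?w k * (join_prob D (q k) * q k - t)) - t * ?w K"
    using excess_partial_sum[of \<mu> K K D l t q] assms by (simp add: excess_ge)
  also have "\<dots> = (\<Sum>k<K. ?w k * (join_prob D (q k) * q k)) - t * (\<Sum>k\<le>K. ?w k)"
  proof -
    have "(\<Sum>k\<le>K. ?w k) = (\<Sum>k<K. ?w k) + ?w K"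
      by (simp flip: lessThan_Suc_atMost)
    then show ?thesis
      by (simp add: algebra_simps sum_subtractf sum_distrib_left)
  qed
  finally have "idle_prob l \<mu> D K q * excess D (l / \<mu>) t K q 0 =
      idle_prob l \<mu> D K q * (\<Sum>k<K. ?w k * (join_prob D (q k) * q k))
        - t * (idle_prob l \<mu> D K q * (\<Sum>k\<le>K. ?w k))"
    by (simp add: right_diff_distrib)
  also have "idle_prob l \<mu> D K q * (\<Sum>k\<le>K. ?w k) = 1"
    using state_prob_sum[OF assms] by (simp add: state_prob_def sum_distrib_left)
  finally have "l * idle_prob l \<mu> D K q * excess D (l / \<mu>) t K q 0 =
      l * (idle_prob l \<mu> D K q * (\<Sum>k<K. ?w k * (join_prob D (q k) * q k))) - l * t"
    by (simp add: right_diff_distrib mult.assoc)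
  also have "l * (idle_prob l \<mu> D K q * (\<Sum>k<K. ?w k * (join_prob D (q k) * q k))) =
      revenue_rate l \<mu> D K q"
    by (simp add: revenue_rate_def state_prob_def sum_distrib_left mult_ac)
  finally show ?thesis
    by simp
qed

section \<open>The optimal revenue rate\<close>

lemma optimal_prices_iff:
  "optimal_prices l \<mu> D K p \<longleftrightarrow> p \<in> price_vectors K \<and>
     (\<forall>q\<in>price_vectors K. revenue_rate l \<mu> D K q \<le> revenue_rate l \<mu> D K p)"
  by (auto simp: optimal_prices_def is_arg_max_linorder)

lemma optimal_revenue_eq:
  "optimal_prices l \<mu> D K p \<Longrightarrow> optimal_revenue \<mu> D K l = revenue_rate l \<mu> D K p"
  unfolding optimal_revenue_def optimal_prices_iff by (rule Greatest_equality) auto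

context valuation
begin

lemma optimal_revenue_pos:
  assumes "1 \<le> K" "0 < l" "0 < \<mu>" "optimal_prices l \<mu> D K p"
  shows "0 < revenue_rate l \<mu> D K p"
proof -
  obtain u where u: "u > 0" "0 < join_prob D u"
    using ex_profitable_price by blast
  define q where "q = restrict (\<lambda>_. u) {..<K}"
  have q: "q \<in> price_vectors K"
    using u by (auto simp: q_def price_vectors_def)
  let ?f = "\<lambda>k. state_prob l \<mu> D K q k * l * join_prob D (q k) * q k"
  \<comment> \<open>State 0 has weight 1 under all prices, so a profitable price there already earns
    something.\<close>
  have "0 < ?f 0"
    using assms u by (simp add: q_def state_prob_def state_weight_def idle_prob_pos)
  also have "\<dots> \<le> revenue_rate l \<mu> D K q"
    unfolding revenue_rate_def using assms q
    by (intro member_le_sum) (auto simp: price_vectors_def PiE_iff state_prob_nonneg)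
  finally show ?thesis
    using assms q by (force simp: optimal_prices_iff)
qed

text \<open>At this charge \<open>p\<close> has excess 0, giving one inequality; a positive value
  would yield a price vector with positive excess, which would earn more than
  \<open>p\<close>.\<close>

lemma value_fn_optimal:
  assumes "0 < l" "0 < \<mu>" "optimal_prices l \<mu> D K p"
  shows "value_fn (l / \<mu>) (revenue_rate l \<mu> D K p / l) K 0 = 0"
proof (rule antisym)
  define t where "t = revenue_rate l \<mu> D K p / l"
  have p: "p \<in> price_vectors K"
    using assms by (simp add: optimal_prices_iff)
  have lt: "l * t = revenue_rate l \<mu> D K p"
    using assms by (simp add: t_def)
  have pos: "0 < l * idle_prob l \<mu> D K q" for q
    using assms by (simp add: idle_prob_pos)
  have "excess D (l / \<mu>) t K p 0 = 0"
    using revenue_rate_excess[of l \<mu> D K p t] lt assms pos[of p] by auto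
  with p show "0 \<le> value_fn (l / \<mu>) (revenue_rate l \<mu> D K p / l) K 0"
    using excess_le_value_fn[of "l / \<mu>" p K 0 t] assms by (simp add: t_def)
  show "value_fn (l / \<mu>) (revenue_rate l \<mu> D K p / l) K 0 \<le> 0"
  proof (rule ccontr)
    assume "\<not> value_fn (l / \<mu>) (revenue_rate l \<mu> D K p / l) K 0 \<le> 0"
    then obtain q where q: "q \<in> price_vectors K" "0 < excess D (l / \<mu>) t K q 0"
      using less_value_fnD[of "l / \<mu>" 0 K 0 t] assms by (auto simp: t_def)
    then have "0 < l * idle_prob l \<mu> D K q * excess D (l / \<mu>) t K q 0"
      using pos by simp
    then have "revenue_rate l \<mu> D K p < revenue_rate l \<mu> D K q"
      using revenue_rate_excess[of l \<mu> D K q t] lt assms by simp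
    with q assms show False
      by (force simp: optimal_prices_iff)
  qed
qed

lemma ex_better_prices:
  assumes "0 < l" "l < l'" "0 < \<mu>" "p \<in> price_vectors K" "0 < revenue_rate l \<mu> D K p"
  shows "\<exists>q\<in>price_vectors K. revenue_rate l \<mu> D K p < revenue_rate l' \<mu> D K q"
proof -
  \<comment> \<open>A price that nobody accepts is left as it is; any other can be raised strictly,
    to where demand has shrunk by the factor \<open>l / l'\<close>.\<close>
  have "\<exists>u'\<ge>u. l' * join_prob D u' = l * join_prob D u \<and> (0 < join_prob D u \<longrightarrow> u < u')" for u
  proof (cases "join_prob D u = 0")
    case False
    then have "0 < join_prob D u"
      by (simp add: less_le)
    then have "l / l' * join_prob D u < join_prob D u" "0 < l / l' * join_prob D u"
      using assms by (auto simp: field_simps)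
    then obtain u' where "u < u'" "join_prob D u' = l / l' * join_prob D u"
      using join_prob_attains by metis
    then show ?thesis
      using assms by (intro exI[of _ u']) auto
  qed auto
  then obtain f where f: "\<And>u. u \<le> f u" "\<And>u. l' * join_prob D (f u) = l * join_prob D u"
      "\<And>u. 0 < join_prob D u \<Longrightarrow> u < f u"
    by metis
  define q where "q = restrict (f \<circ> p) {..<K}"
  have p: "0 \<le> p k" if "k < K" for k
    using assms that by (auto simp: price_vectors_def)
  have q: "q \<in> price_vectors K"
    using order_trans[OF p f(1)] by (auto simp: q_def price_vectors_def)
  \<comment> \<open>The arrival rate and the joining probabilities enter the weights only through
    their products.\<close>
  have weight: "state_weight l' \<mu> D q k = state_weight l \<mu> D p k" if "k \<le> K" for k
  proof -
    have *: "state_weight x \<mu> D r k = (\<Prod>j<k. x * join_prob D (r j)) / (\<mu> ^ k * fact k)" for x r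
      by (simp add: state_weight_def prod.distrib power_divide)
    show ?thesis
      using that by (auto simp: * q_def f(2) intro!: arg_cong2[where f = "(/)"] prod.cong)
  qed
  have prob: "state_prob l' \<mu> D K q k = state_prob l \<mu> D K p k" if "k \<le> K" for k
    using that by (simp add: state_prob_def idle_prob_def weight)
  define c where "c k = state_prob l \<mu> D K p k * (l * join_prob D (p k))" for k
  have c: "0 \<le> c k" for k
    using assms by (simp add: c_def state_prob_nonneg)
  have Rp: "revenue_rate l \<mu> D K p = (\<Sum>k<K. c k * p k)"
    by (simp add: revenue_rate_def c_def mult.assoc)
  have Rq: "revenue_rate l' \<mu> D K q = (\<Sum>k<K. c k * f (p k))"
    unfolding revenue_rate_def c_def
  proof (intro sum.cong refl)
    fix k assume "k \<in> {..<K}"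
    then have "q k = f (p k)"
      by (simp add: q_def)
    with \<open>k \<in> {..<K}\<close> show "state_prob l' \<mu> D K q k * l' * join_prob D (q k) * q k =
        state_prob l \<mu> D K p k * (l * join_prob D (p k)) * f (p k)"
      by (simp add: prob mult.assoc flip: f(2))
  qed
  \<comment> \<open>Positive revenue needs a state with a positive admission rate, and in such a
    state the price went up strictly.\<close>
  have "\<exists>k<K. c k * p k \<noteq> 0"
    using assms Rp by (metis (mono_tags, lifting) lessThan_iff less_irrefl sum.neutral)
  then obtain k where k: "k < K" "c k \<noteq> 0"
    by auto
  then have "0 < c k"
    using c[of k] by linarith
  moreover have "p k < f (p k)"
    using k by (intro f(3)) (auto simp: c_def less_le)
  ultimately have "c k * p k < c k * f (p k)"
    by simp
  then have "revenue_rate l \<mu> D K p < revenue_rate l' \<mu> D K q"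
    unfolding Rp Rq using k c f(1) by (intro sum_strict_mono_ex1) (auto intro!: mult_left_mono)
  with q show ?thesis
    by blast
qed

end

theorem proposition20:
  fixes K :: nat and \<mu> :: real and D :: "real measure"
  assumes "K \<ge> 1"
    and "\<mu> > 0"
    and "valuation_law D"
    and "\<And>l. l > 0 \<Longrightarrow> \<exists>p. optimal_prices l \<mu> D K p"
  shows "strict_mono_on {0<..} (optimal_revenue \<mu> D K) \<and>
         strict_antimono_on {0<..} (\<lambda>l. optimal_revenue \<mu> D K l / l)"
proof -
  interpret valuation D
    by unfold_locales (rule assms)
  have "optimal_revenue \<mu> D K l < optimal_revenue \<mu> D K l' \<and>
      optimal_revenue \<mu> D K l' / l' < optimal_revenue \<mu> D K l / l"
    if l: "0 < l" "l < l'" for l l'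
  proof -
    have "0 < l'"
      using l by simp
    obtain p p' where p: "optimal_prices l \<mu> D K p" and p': "optimal_prices l' \<mu> D K p'"
      using assms(4) l \<open>0 < l'\<close> by blast
    have pos: "0 < revenue_rate l \<mu> D K p"
      using assms l p by (intro optimal_revenue_pos)
    obtain q where "q \<in> price_vectors K" "revenue_rate l \<mu> D K p < revenue_rate l' \<mu> D K q"
      using ex_better_prices[OF l assms(2) _ pos] p by (auto simp: optimal_prices_iff)
    then have "revenue_rate l \<mu> D K p < revenue_rate l' \<mu> D K p'"
      using p' by (force simp: optimal_prices_iff)
    \<comment> \<open>Each optimal revenue per arrival is the charge that makes
      \<open>value_fn\<close> vanish at 0, for the offered loads \<open>l / \<mu>\<close> and
      \<open>l' / \<mu>\<close>.\<close>
    moreover have "revenue_rate l' \<mu> D K p' / l' < revenue_rate l \<mu> D K p / l"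
    proof (rule value_fn_root_strict)
      show "l / \<mu> < l' / \<mu>"
        using l assms by (simp add: divide_strict_right_mono)
    qed (use assms l \<open>0 < l'\<close> pos p p' value_fn_optimal in auto)
    ultimately show ?thesis
      using p p' by (simp add: optimal_revenue_eq)
  qed
  then show ?thesis
    by (auto simp: monotone_on_def)
qed

end
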